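(* Let $M$ be a closed $3$-manifold. There is a residual subset $\mathcal{R}$ of $\mathcal{X}^1(M)$ such that every flow $X\in\mathcal{R}$ exhibiting a nontrivial singular attractor has a singularity which is non isolated in the nonwandering set $\Omega(X)$.
   Context: $\mathcal{X}^1(M)$ is the space of $C^1$ flows on $M$ (each flow $X=X_t$ is identified with the vector field generating it, also denoted $X$), endowed with the $C^1$ topology. A subset of $\mathcal{X}^1(M)$ is residual if it contains a countable intersection of open dense subsets of $\mathcal{X}^1(M)$. A point $p$ is nonwandering for $X$ if for every neighborhood $V$ of $p$ and every $T>0$ there is $t>T$ with $X_t(V)\cap V\neq\emptyset$; $\Omega(X)$ denotes the set of nonwandering points. A singularity $\sigma$ of $X$ (a zero of the vector field $X$) is isolated in the nonwandering set if $\Omega(X)\setminus\{\sigma\}$ is closed in $M$, and non isolated in the nonwandering set otherwise. The $\omega$-limit set of a point $p$ is the set $\omega_X(p)$ of points $q=\lim_{n\to\infty}X_{t_n}(p)$ for some sequence $t_n\to\infty$. An invariant set is transitive if it is the $\omega$-limit set of one of its points. A compact invariant set is singular if it contains a singularity, and attracting if it equals $\bigcap_{t>0}X_t(V)$ for some compact neighborhood $V$ of it satisfying $X_t(V)\subset V$ for all $t>0$. An attractor is a transitive attracting set. An attractor is nontrivial if it is not a single closed orbit (a closed orbit being a periodic orbit or a singularity). *)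

theory Defs
  imports "HOL-Analysis.Analysis"
begin

section \<open>Closed smooth 3-manifolds\<close>

text \<open>\<open>C\<^sup>k\<close> maps on an open subset \<open>S\<close> of a Euclidean space. The derivative is passed to the
  recursion through its directional derivatives, so that the type of the map does not change.\<close>

primrec Ck_on :: "nat \<Rightarrow> 'e::euclidean_space set \<Rightarrow> ('e \<Rightarrow> 'f::real_normed_vector) \<Rightarrow> bool" where
  "Ck_on 0 S f \<longleftrightarrow> continuous_on S f"
| "Ck_on (Suc k) S f \<longleftrightarrow>
     f differentiable_on S \<and> (\<forall>h. Ck_on k S (\<lambda>x. frechet_derivative f (at x) h))"

definition smooth_on :: "'e::euclidean_space set \<Rightarrow> ('e \<Rightarrow> 'f::real_normed_vector) \<Rightarrow> bool" where
  "smooth_on S f \<longleftrightarrow> (\<forall>k. Ck_on k S f)"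

text \<open>The manifold is the whole type \<open>'a\<close>. A chart is a pair \<open>(U, \<phi>)\<close>; the values of \<open>\<phi>\<close> outside
  the chart domain \<open>U\<close> are irrelevant. All charts take values in open subsets of
  \<open>real^3\<close>, so there is no boundary.\<close>

type_synonym 'a atlas = "('a set \<times> ('a \<Rightarrow> real^3)) set"

definition chart :: "'a::topological_space set \<Rightarrow> ('a \<Rightarrow> real^3) \<Rightarrow> bool" where
  "chart U \<phi> \<longleftrightarrow> open U \<and> open (\<phi> ` U) \<and> homeomorphism U (\<phi> ` U) \<phi> (inv_into U \<phi>)"

definition smooth_atlas :: "'a::topological_space atlas \<Rightarrow> bool" where
  "smooth_atlas A \<longleftrightarrow>
     (\<forall>(U, \<phi>)\<in>A. chart U \<phi>) \<and>
     (\<Union>(U, \<phi>)\<in>A. U) = UNIV \<and>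
     (\<forall>(U, \<phi>)\<in>A. \<forall>(V, \<psi>)\<in>A. smooth_on (\<phi> ` (U \<inter> V)) (\<psi> \<circ> inv_into U \<phi>))"

definition closed_3_manifold :: "'a::{t2_space, second_countable_topology} atlas \<Rightarrow> bool" where
  "closed_3_manifold A \<longleftrightarrow> smooth_atlas A \<and> compact (UNIV :: 'a set)"


section \<open>The space of C1 flows\<close>

definition flow :: "(real \<Rightarrow> 'a::topological_space \<Rightarrow> 'a) \<Rightarrow> bool" where
  "flow X \<longleftrightarrow>
     (\<forall>p. X 0 p = p) \<and>
     (\<forall>s t p. X (s + t) p = X s (X t p)) \<and>
     continuous_on UNIV (\<lambda>(t, p). X t p)"

text \<open>The vector field generating \<open>X\<close> assigns to \<open>p\<close> the velocity at time \<open>0\<close> of the trajectory of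
  \<open>p\<close>; \<open>velocity \<phi> X p\<close> is its coordinate vector in a chart \<open>\<phi>\<close> around \<open>p\<close>, and
  \<open>local_field U \<phi> X\<close> is the representative of the vector field on \<open>\<phi> ` U\<close>. By the chain rule these
  representatives transform under coordinate changes like a section of the tangent bundle.\<close>

definition velocity :: "('a \<Rightarrow> real^3) \<Rightarrow> (real \<Rightarrow> 'a \<Rightarrow> 'a) \<Rightarrow> 'a \<Rightarrow> real^3" where
  "velocity \<phi> X p = vector_derivative (\<lambda>t. \<phi> (X t p)) (at 0)"

definition local_field :: "'a set \<Rightarrow> ('a \<Rightarrow> real^3) \<Rightarrow> (real \<Rightarrow> 'a \<Rightarrow> 'a) \<Rightarrow> real^3 \<Rightarrow> real^3" where
  "local_field U \<phi> X x = velocity \<phi> X (inv_into U \<phi> x)"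

text \<open>The flows generated by a \<open>C\<^sup>1\<close> vector field. On a closed manifold every \<open>C\<^sup>1\<close> vector field
  generates exactly one flow, so these flows are in bijection with the \<open>C\<^sup>1\<close> vector fields.\<close>

definition C1_flows :: "'a::topological_space atlas \<Rightarrow> (real \<Rightarrow> 'a \<Rightarrow> 'a) set" where
  "C1_flows A = {X. flow X \<and>
     (\<forall>(U, \<phi>)\<in>A. (\<forall>p\<in>U. (\<lambda>t. \<phi> (X t p)) differentiable (at 0)) \<and>
                   Ck_on 1 (\<phi> ` U) (local_field U \<phi> X))}"

text \<open>The \<open>C\<^sup>1\<close> topology is uniform convergence of the vector field and its first derivative on
  compact subsets of charts.\<close>

definition C1_neighborhood ::
  "'a::topological_space atlas \<Rightarrow> (real \<Rightarrow> 'a \<Rightarrow> 'a) \<Rightarrow> 'a set \<Rightarrow> ('a \<Rightarrow> real^3) \<Rightarrow> (real^3) set \<Rightarrow> real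
     \<Rightarrow> (real \<Rightarrow> 'a \<Rightarrow> 'a) set" where
  "C1_neighborhood A X U \<phi> K \<epsilon> = {Y \<in> C1_flows A. \<forall>x\<in>K.
     norm (local_field U \<phi> Y x - local_field U \<phi> X x) < \<epsilon> \<and>
     onorm (\<lambda>h. frechet_derivative (local_field U \<phi> Y) (at x) h
               - frechet_derivative (local_field U \<phi> X) (at x) h) < \<epsilon>}"

definition C1_topology :: "'a::topological_space atlas \<Rightarrow> (real \<Rightarrow> 'a \<Rightarrow> 'a) topology" where
  "C1_topology A = topology_generated_by
     {C1_neighborhood A X U \<phi> K \<epsilon> | X U \<phi> K \<epsilon>.
        X \<in> C1_flows A \<and> (U, \<phi>) \<in> A \<and> compact K \<and> K \<subseteq> \<phi> ` U \<and> 0 < \<epsilon>}"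

definition residual_in :: "'b topology \<Rightarrow> 'b set \<Rightarrow> bool" where
  "residual_in T R \<longleftrightarrow> R \<subseteq> topspace T \<and>
     (\<exists>D :: nat \<Rightarrow> 'b set.
        (\<forall>n. openin T (D n) \<and> T closure_of D n = topspace T) \<and> (\<Inter>n. D n) \<subseteq> R)"


section \<open>Dynamics\<close>

text \<open>A neighborhood of a point or set is any set whose interior contains it.\<close>

definition nonwandering :: "(real \<Rightarrow> 'a::topological_space \<Rightarrow> 'a) \<Rightarrow> 'a set" where
  "nonwandering X =
     {p. \<forall>V T. p \<in> interior V \<and> 0 < T \<longrightarrow> (\<exists>t>T. X t ` V \<inter> V \<noteq> {})}"

definition singularity :: "'a atlas \<Rightarrow> (real \<Rightarrow> 'a \<Rightarrow> 'a) \<Rightarrow> 'a \<Rightarrow> bool" where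
  "singularity A X \<sigma> \<longleftrightarrow> (\<forall>(U, \<phi>)\<in>A. \<sigma> \<in> U \<longrightarrow> velocity \<phi> X \<sigma> = 0)"

definition isolated_in_nonwandering :: "(real \<Rightarrow> 'a::topological_space \<Rightarrow> 'a) \<Rightarrow> 'a \<Rightarrow> bool" where
  "isolated_in_nonwandering X \<sigma> \<longleftrightarrow> closed (nonwandering X - {\<sigma>})"

definition omega_limit :: "(real \<Rightarrow> 'a::topological_space \<Rightarrow> 'a) \<Rightarrow> 'a \<Rightarrow> 'a set" where
  "omega_limit X p =
     {q. \<exists>s :: nat \<Rightarrow> real. filterlim s at_top sequentially \<and> (\<lambda>n. X (s n) p) \<longlonglongrightarrow> q}"

definition invariant :: "(real \<Rightarrow> 'a \<Rightarrow> 'a) \<Rightarrow> 'a set \<Rightarrow> bool" where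
  "invariant X L \<longleftrightarrow> (\<forall>t. X t ` L = L)"

definition transitive_set :: "(real \<Rightarrow> 'a::topological_space \<Rightarrow> 'a) \<Rightarrow> 'a set \<Rightarrow> bool" where
  "transitive_set X L \<longleftrightarrow> invariant X L \<and> (\<exists>p\<in>L. L = omega_limit X p)"

definition singular_set ::
  "'a::topological_space atlas \<Rightarrow> (real \<Rightarrow> 'a \<Rightarrow> 'a) \<Rightarrow> 'a set \<Rightarrow> bool" where
  "singular_set A X L \<longleftrightarrow> compact L \<and> invariant X L \<and> (\<exists>\<sigma>\<in>L. singularity A X \<sigma>)"

definition attracting_set :: "(real \<Rightarrow> 'a::topological_space \<Rightarrow> 'a) \<Rightarrow> 'a set \<Rightarrow> bool" where
  "attracting_set X L \<longleftrightarrow> compact L \<and> invariant X L \<and>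
     (\<exists>V. compact V \<and> L \<subseteq> interior V \<and> (\<forall>t>0. X t ` V \<subseteq> V) \<and> L = (\<Inter>t\<in>{0<..}. X t ` V))"

definition attractor :: "(real \<Rightarrow> 'a::topological_space \<Rightarrow> 'a) \<Rightarrow> 'a set \<Rightarrow> bool" where
  "attractor X L \<longleftrightarrow> transitive_set X L \<and> attracting_set X L"

definition periodic_orbit :: "'a atlas \<Rightarrow> (real \<Rightarrow> 'a \<Rightarrow> 'a) \<Rightarrow> 'a set \<Rightarrow> bool" where
  "periodic_orbit A X L \<longleftrightarrow>
     (\<exists>p. \<not> singularity A X p \<and> (\<exists>T>0. X T p = p) \<and> L = range (\<lambda>t. X t p))"

definition closed_orbit :: "'a atlas \<Rightarrow> (real \<Rightarrow> 'a \<Rightarrow> 'a) \<Rightarrow> 'a set \<Rightarrow> bool" where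
  "closed_orbit A X L \<longleftrightarrow> periodic_orbit A X L \<or> (\<exists>\<sigma>. singularity A X \<sigma> \<and> L = {\<sigma>})"

definition nontrivial_attractor ::
  "'a::topological_space atlas \<Rightarrow> (real \<Rightarrow> 'a \<Rightarrow> 'a) \<Rightarrow> 'a set \<Rightarrow> bool" where
  "nontrivial_attractor A X L \<longleftrightarrow> attractor X L \<and> \<not> closed_orbit A X L"

end

theory Submission
  imports Defs
begin

text \<open>The conclusion holds for every \<open>C\<^sup>1\<close> flow, so the whole space serves as the residual set. Let
  \<open>L\<close> be a nontrivial singular attractor, say \<open>L = \<omega>(p)\<close> with \<open>p \<in> L\<close>, and let \<open>\<sigma> \<in> L\<close> be a
  singularity. An \<open>\<omega>\<close>-limit set consists of nonwandering points, so the invariant set \<open>L\<close>, and with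
  it the orbit of \<open>p\<close>, lies in the nonwandering set. Since \<open>\<sigma> \<in> \<omega>(p)\<close>, this orbit accumulates on
  \<open>\<sigma>\<close>. It never meets \<open>\<sigma>\<close>: a singularity of a \<open>C\<^sup>1\<close> field is a rest point of the flow, so an orbit
  through \<open>\<sigma>\<close> is constant, and then \<open>L = {\<sigma>}\<close> would be a closed orbit. Thus \<open>\<sigma>\<close> is a limit of
  nonwandering points other than \<open>\<sigma>\<close>, which is to say that it is not isolated in the nonwandering
  set.

  The one step that uses regularity is that a singularity is a rest point (lemma
  \<open>singularity_rest_point\<close>). In general this is uniqueness for ordinary differential equations; for a
  constant solution it follows from a linear bound on the field near its zero, which
  differentiability at that point provides.\<close>

section \<open>Singularities are rest points\<close>

text \<open>The constant solution is the only one when the speed is at most \<open>C\<close> times the distance to the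
  initial point: on \<open>[0, \<delta>]\<close> the largest distance \<open>m\<close> satisfies \<open>m \<le> C m \<delta>\<close> by the mean value
  inequality, so \<open>m = 0\<close> as soon as \<open>C \<delta> < 1\<close>.\<close>

lemma constant_if_speed_le_distance:
  fixes f :: "real \<Rightarrow> 'b::real_normed_vector"
  assumes deriv: "\<And>t. t \<in> {0..\<delta>} \<Longrightarrow> (f has_vector_derivative g t) (at t)"
    and speed: "\<And>t. t \<in> {0..\<delta>} \<Longrightarrow> norm (g t) \<le> C * norm (f t - f 0)"
    and "0 \<le> C" and "C * \<delta> < 1" and t: "t \<in> {0..\<delta>}"
  shows "f t = f 0"
proof -
  have "continuous_on {0..\<delta>} (\<lambda>t. norm (f t - f 0))"
    by (intro continuous_intros continuous_at_imp_continuous_on)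
      (use deriv has_vector_derivative_continuous in blast)
  then obtain u where u: "u \<in> {0..\<delta>}"
    and max: "\<And>s. s \<in> {0..\<delta>} \<Longrightarrow> norm (f s - f 0) \<le> norm (f u - f 0)"
    using continuous_attains_sup[of "{0..\<delta>}" "\<lambda>t. norm (f t - f 0)"] t by auto
  let ?m = "norm (f u - f 0)"
  have "norm (f u - f 0) \<le> (C * ?m) * norm (u - 0)"
  proof (rule differentiable_bound[where f' = "\<lambda>t h. h *\<^sub>R g t"])
    show "(f has_derivative (\<lambda>h. h *\<^sub>R g s)) (at s within {0..\<delta>})" if "s \<in> {0..\<delta>}" for s
      using deriv[OF that] has_derivative_at_withinI by (auto simp: has_vector_derivative_def)
    show "onorm (\<lambda>h. h *\<^sub>R g s) \<le> C * ?m" if "s \<in> {0..\<delta>}" for s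
    proof (rule onorm_bound)
      have "norm (g s) \<le> C * ?m"
        using speed[OF that] mult_left_mono[OF max[OF that] \<open>0 \<le> C\<close>] by linarith
      then show "norm (h *\<^sub>R g s) \<le> C * ?m * norm h" for h :: real
        using mult_left_mono[of "norm (g s)" "C * ?m" "\<bar>h\<bar>"] by (simp add: mult.commute)
    qed (use \<open>0 \<le> C\<close> in simp)
  qed (use u in auto)
  also have "\<dots> \<le> (C * ?m) * \<delta>"
    using u \<open>0 \<le> C\<close> by (intro mult_left_mono) auto
  finally have "?m * (1 - C * \<delta>) \<le> 0"
    by (simp add: algebra_simps)
  then have "?m \<le> 0"
    using \<open>C * \<delta> < 1\<close> by (simp add: mult_le_0_iff)
  with max[OF t] show ?thesis
    by simp
qed

lemma differentiable_linear_bound_near: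
  fixes f :: "'b::real_normed_vector \<Rightarrow> 'c::real_normed_vector"
  assumes "f differentiable (at x)"
  obtains C d where "0 < C" "0 < d" "\<And>y. dist y x < d \<Longrightarrow> norm (f y - f x) \<le> C * norm (y - x)"
proof -
  obtain f' where f': "(f has_derivative f') (at x)"
    using assms by (auto simp: differentiable_def)
  then obtain B where "0 < B" and B: "\<And>h. norm (f' h) \<le> norm h * B"
    using bounded_linear.pos_bounded has_derivative_bounded_linear by blast
  obtain d where "0 < d"
    and d: "\<And>y. norm (y - x) < d \<Longrightarrow> norm (f y - f x - f' (y - x)) \<le> 1 * norm (y - x)"
    using f' unfolding has_derivative_at_alt by (meson zero_less_one)
  show ?thesis
  proof
    show "norm (f y - f x) \<le> (1 + B) * norm (y - x)" if "dist y x < d" for y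
      using d[of y] B[of "y - x"] that
        norm_triangle_ineq[of "f y - f x - f' (y - x)" "f' (y - x)"]
      by (simp add: dist_norm algebra_simps)
  qed (use \<open>0 < B\<close> \<open>0 < d\<close> in auto)
qed

lemma flow_continuous_in_time:
  assumes "flow X"
  shows "continuous_on UNIV (\<lambda>t. X t p)"
proof -
  have "continuous_on UNIV (\<lambda>(t, p). X t p)"
    using assms by (simp add: flow_def)
  from continuous_on_compose2[OF this, of UNIV "\<lambda>t. (t, p)"]
  show ?thesis
    by (simp add: continuous_on_Pair)
qed

text \<open>The group law turns differentiability at time \<open>0\<close>, at every point of a chart, into the
  differential equation along a whole piece of trajectory in that chart.\<close>

lemma C1_flow_has_vector_derivative:
  assumes X: "X \<in> C1_flows A" and "(U, \<phi>) \<in> A" and "X t p \<in> U"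
  shows "((\<lambda>t. \<phi> (X t p)) has_vector_derivative velocity \<phi> X (X t p)) (at t)"
proof -
  have "(\<lambda>s. \<phi> (X s (X t p))) differentiable (at 0)"
    using assms by (auto simp: C1_flows_def)
  then have "((\<lambda>s. \<phi> (X s (X t p))) has_vector_derivative velocity \<phi> X (X t p)) (at 0)"
    unfolding velocity_def by (simp add: vector_derivative_works)
  moreover have "X s (X t p) = X (s + t) p" for s
    using X by (simp add: C1_flows_def flow_def)
  ultimately have "((\<lambda>s. \<phi> (X (s + t) p)) has_vector_derivative velocity \<phi> X (X t p)) (at 0)"
    by simp
  then have "((\<lambda>s. \<phi> (X (s + t) p)) \<circ> (\<lambda>s. s - t) has_vector_derivative
      1 *\<^sub>R velocity \<phi> X (X t p)) (at t)"
    by (intro vector_diff_chain_at) (auto intro!: derivative_eq_intros)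
  then show ?thesis
    by (simp add: o_def)
qed

lemma singularity_rest_near_zero:
  fixes A :: "'a::topological_space atlas"
  assumes atlas: "smooth_atlas A" and X: "X \<in> C1_flows A" and sing: "singularity A X \<sigma>"
  obtains \<delta> where "0 < \<delta>" "\<And>t. t \<in> {0..\<delta>} \<Longrightarrow> X t \<sigma> = \<sigma>"
proof -
  have "\<sigma> \<in> (\<Union>(U, \<phi>)\<in>A. U)"
    using atlas unfolding smooth_atlas_def by (metis UNIV_I)
  then obtain U \<phi> where U: "(U, \<phi>) \<in> A" "\<sigma> \<in> U"
    by blast
  have "chart U \<phi>"
    using atlas U unfolding smooth_atlas_def by blast
  have ch: "open U" "open (\<phi> ` U)" and hom: "homeomorphism U (\<phi> ` U) \<phi> (inv_into U \<phi>)"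
    using \<open>chart U \<phi>\<close> by (auto simp: chart_def)
  have inv: "inv_into U \<phi> (\<phi> q) = q" if "q \<in> U" for q
    using hom that by (auto simp: homeomorphism_def)
  have X0: "X 0 \<sigma> = \<sigma>" and "flow X"
    using X by (auto simp: C1_flows_def flow_def)
  have field: "local_field U \<phi> X (\<phi> q) = velocity \<phi> X q" if "q \<in> U" for q
    using inv[OF that] by (simp add: local_field_def)
  have zero: "local_field U \<phi> X (\<phi> \<sigma>) = 0"
    using sing U field by (auto simp: singularity_def)
  have "Ck_on 1 (\<phi> ` U) (local_field U \<phi> X)"
    using X U by (auto simp: C1_flows_def)
  then have "local_field U \<phi> X differentiable (at (\<phi> \<sigma>))"
    using ch U by (auto simp: differentiable_on_eq_differentiable_at)
  then obtain C d where "0 < C" "0 < d"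
    and C: "\<And>y. dist y (\<phi> \<sigma>) < d \<Longrightarrow> norm (local_field U \<phi> X y) \<le> C * norm (y - \<phi> \<sigma>)"
    by (rule differentiable_linear_bound_near) (use zero in auto)
  define W where "W = U \<inter> \<phi> -` ball (\<phi> \<sigma>) d"
  have "open W"
    unfolding W_def using hom ch
    by (intro continuous_open_preimage) (auto simp: homeomorphism_def)
  then have "open ((\<lambda>t. X t \<sigma>) -` W)"
    by (rule open_vimage) (rule flow_continuous_in_time[OF \<open>flow X\<close>])
  moreover have "0 \<in> (\<lambda>t. X t \<sigma>) -` W"
    using U \<open>0 < d\<close> X0 by (simp add: W_def)
  ultimately obtain e where "0 < e" and e: "\<And>t. dist t 0 < e \<Longrightarrow> X t \<sigma> \<in> W"
    unfolding open_dist by blast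
  \<comment> \<open>Short enough for the trajectory to remain in \<open>W\<close> and for \<open>C \<delta> < 1\<close>.\<close>
  define \<delta> where "\<delta> = min (e / 2) (1 / (2 * C))"
  have "0 < \<delta>" "\<delta> < e"
    using \<open>0 < e\<close> \<open>0 < C\<close> by (auto simp: \<delta>_def)
  have "C * \<delta> \<le> C * (1 / (2 * C))"
    using \<open>0 < C\<close> by (intro mult_left_mono) (auto simp: \<delta>_def)
  then have "C * \<delta> < 1"
    using \<open>0 < C\<close> by simp
  have inW: "X t \<sigma> \<in> U" "dist (\<phi> (X t \<sigma>)) (\<phi> \<sigma>) < d" if "t \<in> {0..\<delta>}" for t
    using e[of t] that \<open>\<delta> < e\<close> by (auto simp: W_def dist_commute)
  have "\<phi> (X t \<sigma>) = \<phi> (X 0 \<sigma>)" if "t \<in> {0..\<delta>}" for t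
  proof (rule constant_if_speed_le_distance[where f = "\<lambda>t. \<phi> (X t \<sigma>)"])
    show "((\<lambda>t. \<phi> (X t \<sigma>)) has_vector_derivative velocity \<phi> X (X s \<sigma>)) (at s)"
      if "s \<in> {0..\<delta>}" for s
      using C1_flow_has_vector_derivative[OF X] U inW[OF that] by blast
    show "norm (velocity \<phi> X (X s \<sigma>)) \<le> C * norm (\<phi> (X s \<sigma>) - \<phi> (X 0 \<sigma>))"
      if "s \<in> {0..\<delta>}" for s
      using C[OF inW(2)[OF that]] field inW[OF that] X0 by simp
  qed (use that \<open>0 < C\<close> \<open>C * \<delta> < 1\<close> in auto)
  then have "X t \<sigma> = \<sigma>" if "t \<in> {0..\<delta>}" for t
    using inv inW(1) U that X0 by metis
  with \<open>0 < \<delta>\<close> show ?thesis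
    by (rule that)
qed

text \<open>Rest on a short time interval propagates to all times by the group law: every \<open>t\<close> is an
  integer multiple of some time in the interval, up to sign.\<close>

lemma singularity_rest_point:
  fixes A :: "'a::topological_space atlas"
  assumes "smooth_atlas A" and X: "X \<in> C1_flows A" and "singularity A X \<sigma>"
  shows "X t \<sigma> = \<sigma>"
proof -
  obtain \<delta> where "0 < \<delta>" and \<delta>: "\<And>t. t \<in> {0..\<delta>} \<Longrightarrow> X t \<sigma> = \<sigma>"
    using singularity_rest_near_zero[OF assms] by blast
  have X0: "X 0 \<sigma> = \<sigma>" and add: "X (s + t) \<sigma> = X s (X t \<sigma>)" for s t
    using X by (auto simp: C1_flows_def flow_def)
  have multiple: "X (real n * s) \<sigma> = \<sigma>" if "s \<in> {0..\<delta>}" for n s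
    by (induction n) (simp_all add: X0 add \<delta>[OF that] distrib_right)
  have forward: "X t \<sigma> = \<sigma>" if "0 \<le> t" for t
  proof -
    obtain n where "t / \<delta> < real n"
      using reals_Archimedean2 by blast
    moreover have "0 \<le> t / \<delta>"
      using that \<open>0 < \<delta>\<close> by simp
    ultimately have "0 < real n" "t < real n * \<delta>"
      using \<open>0 < \<delta>\<close> by (linarith, simp add: pos_divide_less_eq)
    then have "t / real n \<in> {0..\<delta>}"
      using that by (simp add: pos_divide_le_eq mult.commute)
    from multiple[OF this, of n] show ?thesis
      using \<open>0 < real n\<close> by simp
  qed
  show ?thesis
  proof (cases "0 \<le> t")
    case False
    then have "X t \<sigma> = X t (X (- t) \<sigma>)"
      by (simp add: forward)
    also have "\<dots> = \<sigma>"
      using add[of t "- t"] X0 by simp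
    finally show ?thesis .
  qed (rule forward)
qed

section \<open>Limit sets and nonwandering points\<close>

text \<open>A forward orbit that converges along a sequence of times returns to any neighborhood of the
  limit, and the return times between two visits are arbitrarily long.\<close>

lemma omega_limit_subset_nonwandering:
  assumes "flow X"
  shows "omega_limit X p \<subseteq> nonwandering X"
proof
  fix q assume "q \<in> omega_limit X p"
  then obtain s :: "nat \<Rightarrow> real" where s: "filterlim s at_top sequentially"
    and lim: "(\<lambda>n. X (s n) p) \<longlonglongrightarrow> q"
    by (auto simp: omega_limit_def)
  show "q \<in> nonwandering X"
    unfolding nonwandering_def mem_Collect_eq
  proof (intro allI impI)
    fix V T assume "q \<in> interior V \<and> (0::real) < T"
    then have "\<forall>\<^sub>F n in sequentially. X (s n) p \<in> interior V"
      using topological_tendstoD[OF lim] by auto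
    then obtain N where N: "\<And>n. n \<ge> N \<Longrightarrow> X (s n) p \<in> V"
      unfolding eventually_sequentially using interior_subset by blast
    have "\<forall>\<^sub>F n in sequentially. s N + T < s n"
      using s by (simp add: filterlim_at_top_dense)
    then obtain n where n: "n \<ge> N" "s N + T < s n"
      unfolding eventually_sequentially by (metis max.cobounded1 max.cobounded2)
    have "X (s n - s N) (X (s N) p) = X (s n) p"
      using \<open>flow X\<close> unfolding flow_def by (metis diff_add_cancel)
    then have "X (s n) p \<in> X (s n - s N) ` V \<inter> V"
      using N n by (metis IntI imageI order_refl)
    with n show "\<exists>t>T. X t ` V \<inter> V \<noteq> {}"
      by (intro exI[of _ "s n - s N"]) auto
  qed
qed

lemma omega_limit_rest_point:
  fixes p :: "'a::t2_space"
  assumes "\<And>t. X t p = p"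
  shows "omega_limit X p = {p}"
proof -
  have "p \<in> omega_limit X p"
    using assms filterlim_real_sequentially by (auto simp: omega_limit_def)
  then show ?thesis
    using assms LIMSEQ_unique by (fastforce simp: omega_limit_def LIMSEQ_const_iff)
qed

section \<open>Singularities in transitive sets\<close>

lemma singularity_in_transitive_set_not_isolated:
  fixes A :: "'a::t2_space atlas"
  assumes "smooth_atlas A" and X: "X \<in> C1_flows A" and "transitive_set X L"
    and sing: "singularity A X \<sigma>" "\<sigma> \<in> L" and "L \<noteq> {\<sigma>}"
  shows "\<not> isolated_in_nonwandering X \<sigma>"
proof
  assume iso: "isolated_in_nonwandering X \<sigma>"
  obtain p where "p \<in> L" and L: "L = omega_limit X p" and "invariant X L"
    using \<open>transitive_set X L\<close> by (auto simp: transitive_set_def)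
  have "flow X"
    using X by (simp add: C1_flows_def)
  have rest: "X t \<sigma> = \<sigma>" for t
    using singularity_rest_point[OF assms(1) X sing(1)] .
  have orbit: "X t p \<in> nonwandering X - {\<sigma>}" for t
  proof -
    have "X t p \<in> L"
      using \<open>invariant X L\<close> \<open>p \<in> L\<close> by (auto simp: invariant_def)
    moreover have "X t p \<noteq> \<sigma>"
    proof
      assume "X t p = \<sigma>"
      moreover have "X (- t) (X t p) = p"
        using \<open>flow X\<close> unfolding flow_def by (metis add.left_inverse)
      ultimately have "p = \<sigma>"
        using rest by simp
      then show False
        using omega_limit_rest_point[of X \<sigma>] rest L \<open>L \<noteq> {\<sigma>}\<close> by simp
    qed
    ultimately show ?thesis
      using omega_limit_subset_nonwandering[OF \<open>flow X\<close>] L by auto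
  qed
  obtain s :: "nat \<Rightarrow> real" where "(\<lambda>n. X (s n) p) \<longlonglongrightarrow> \<sigma>"
    using \<open>\<sigma> \<in> L\<close> L by (auto simp: omega_limit_def)
  then have "\<sigma> \<in> nonwandering X - {\<sigma>}"
    using iso orbit unfolding isolated_in_nonwandering_def
    by (intro Lim_in_closed_set[of _ "\<lambda>n. X (s n) p" sequentially]) auto
  then show False
    by simp
qed

theorem corollary1p3:
  fixes A :: "'a::{t2_space, second_countable_topology} atlas"
  assumes "closed_3_manifold A"
  shows "\<exists>R. residual_in (C1_topology A) R \<and>
           (\<forall>X\<in>R. (\<exists>L. nontrivial_attractor A X L \<and> singular_set A X L) \<longrightarrow>
              (\<exists>\<sigma>. singularity A X \<sigma> \<and> \<not> isolated_in_nonwandering X \<sigma>))"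
proof (rule exI[of _ "topspace (C1_topology A)"], intro conjI ballI impI)
  show "residual_in (C1_topology A) (topspace (C1_topology A))"
    unfolding residual_in_def
    by (intro conjI exI[of _ "\<lambda>_. topspace (C1_topology A)"]) auto
next
  fix X assume "X \<in> topspace (C1_topology A)"
  then have X: "X \<in> C1_flows A"
    by (auto simp: C1_topology_def topology_generated_by_topspace C1_neighborhood_def)
  assume "\<exists>L. nontrivial_attractor A X L \<and> singular_set A X L"
  then obtain L \<sigma> where L: "nontrivial_attractor A X L" and \<sigma>: "\<sigma> \<in> L" "singularity A X \<sigma>"
    by (auto simp: singular_set_def)
  have "transitive_set X L" "L \<noteq> {\<sigma>}"
    using L \<sigma> by (auto simp: nontrivial_attractor_def attractor_def closed_orbit_def)
  moreover have "smooth_atlas A"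
    using assms by (simp add: closed_3_manifold_def)
  ultimately have "\<not> isolated_in_nonwandering X \<sigma>"
    using X \<sigma> by (intro singularity_in_transitive_set_not_isolated)
  with \<sigma> show "\<exists>\<sigma>. singularity A X \<sigma> \<and> \<not> isolated_in_nonwandering X \<sigma>"
    by blast
qed

end
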